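(* Let $n$ be a non-negative integer. Let $q,a,x$ be complex numbers (with a fixed choice of square root $q^{1/2}$) for which $q,a\neq 0$ and no denominator occurring below vanishes (equivalently, the identity is one of rational functions in indeterminates). Then $$ \left\{{}_{3}\phi_{2}\left[\begin{array}{c} q^{-n}, a, x\\ x^2,\, 0\end{array};q,q\right]\right\}^2 =a^n\, {}_{5}\phi_{4}\left[\begin{array}{c} q^{-n}, x^2q^{n}, a, x^2/a, x\\ x^2,-x, xq^{\frac{1}{2}}, -xq^{\frac{1}{2}}\end{array};q,q\right]. $$
   Context: The $q$-shifted factorial is $(a;q)_0=1$ and $(a;q)_k=(1-a)(1-aq)\cdots(1-aq^{k-1})$ for $k\geq 1$. The basic hypergeometric series is $$ {}_{r}\phi_{s}\left[\begin{array}{c} a_1,\ldots,a_{r}\\ b_1,\ldots,b_{s}\end{array};q, z\right] =\sum_{k=0}^{\infty}\frac{(a_1;q)_k\cdots (a_r;q)_k}{(q;q)_k (b_1;q)_k \cdots (b_s;q)_k}\left((-1)^k q^{k(k-1)/2}\right)^{1+s-r} z^k . $$ When one of the upper parameters is $q^{-n}$ with $n$ a non-negative integer, the series terminates: $(q^{-n};q)_k=0$ for $k>n$, so the sum is the finite sum over $0\le k\le n$. Note that $(0;q)_k=1$. *)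

theory Defs
  imports Complex_Main
begin

definition qshift :: "complex \<Rightarrow> complex \<Rightarrow> nat \<Rightarrow> complex" where
  "qshift a q k = (\<Prod>i<k. 1 - a * q ^ i)"

text \<open>
  The parameter lists carry \<open>r = length as\<close> and \<open>s = length bs\<close>; the exponent
  \<open>1 + s - r\<close> may be negative and is taken in the integers.
  If some upper parameter is \<open>q\<^sup>-\<^sup>n\<close>, all terms with \<open>k > n\<close> are \<open>0\<close>
  (also those with a vanishing denominator, as \<open>0 / 0 = 0\<close>), so that the series is
  the finite sum over \<open>0 \<le> k \<le> n\<close>.
\<close>

definition basic_hypergeometric ::
    "complex list \<Rightarrow> complex list \<Rightarrow> complex \<Rightarrow> complex \<Rightarrow> complex" where
  "basic_hypergeometric as bs q z =
     (\<Sum>k. (\<Prod>a\<leftarrow>as. qshift a q k) / (qshift q q k * (\<Prod>b\<leftarrow>bs. qshift b q k))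
          * ((- 1) ^ k * q ^ (k * (k - 1) div 2)) powi (1 + int (length bs) - int (length as))
          * z ^ k)"

end

theory Submission
  imports Defs
begin

text \<open>
  Put \<open>y = q\<^sup>-\<^sup>n\<close> and write \<open>F y\<close> for the \<open>\<^sub>3\<phi>\<^sub>2\<close> and \<open>S y\<close> for the \<open>\<^sub>5\<phi>\<^sub>4\<close>, so that
  \<open>y / q\<close> and \<open>q * y\<close> stand for \<open>n + 1\<close> and \<open>n - 1\<close>. Up to a factor, \<open>F y\<close> is a Rogers
  (continuous \<open>q\<close>-ultraspherical) polynomial, and it satisfies the three-term recurrence
  \<open>\<alpha> F(y/q) = (a + x) \<beta> F(y) - a x \<gamma> F(q y)\<close> with \<open>\<alpha> = 1 - x\<^sup>2/y\<close>, \<open>\<beta> = 1 - x/y\<close>, \<open>\<gamma> = 1 - 1/y\<close>.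

  Squaring this recurrence produces the mixed product \<open>F(q y) F(y)\<close>, so the squares alone do not
  close up. The mixed products have an expansion of the same kind: for \<open>y = q\<^sup>-\<^sup>n\<close>,
  \<open>F(y) F(y/q) = (a + x) a\<^sup>n T(y)\<close>, where \<open>(1 + x) T(y)\<close> is the \<open>\<^sub>5\<phi>\<^sub>4\<close> with upper parameters
  \<open>y, q x\<^sup>2/y, a, x\<^sup>2/a, x\<close> and lower parameters \<open>x\<^sup>2, - q x, x p, - x p\<close> and \<open>p\<^sup>2 = q\<close>.
  Multiplying the recurrence by \<open>F y\<close>, and squaring it, shows which two linear relations between
  values of \<open>S\<close> and \<open>T\<close> are needed to prove both product formulas together by induction on \<open>n\<close>
  (\<open>product_formulas\<close>); these are \<open>T_recurrence\<close> and \<open>S_recurrence\<close>.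

  All three recurrences hold coefficientwise, for \<open>F\<close> in the basis \<open>(a;q)\<^sub>k\<close> and for \<open>S\<close> and \<open>T\<close>
  in the basis \<open>(a;q)\<^sub>k (x\<^sup>2/a;q)\<^sub>k\<close>. Multiplication by \<open>a\<close> in the first basis, and by
  \<open>(a + x)\<^sup>2/a\<close> in the second, is bidiagonal, so that each recurrence reduces to one identity between
  rational functions of \<open>x\<close>, \<open>y\<close>, \<open>q\<close> and \<open>q\<^sup>k\<close>.
\<close>

section \<open>Shifted factorials\<close>

lemma qshift_0 [simp]: "qshift b q 0 = 1"
  by (simp add: qshift_def)

lemma qshift_Suc: "qshift b q (Suc k) = qshift b q k * (1 - b * q ^ k)"
  by (simp add: qshift_def)

lemma qshift_Suc_left: "qshift b q (Suc k) = (1 - b) * qshift (b * q) q k"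
  by (induction k) (simp_all add: qshift_Suc mult.assoc)

lemma qshift_nonzero_mono:
  assumes "qshift b q k \<noteq> 0" "i \<le> k"
  shows "qshift b q i \<noteq> 0"
  using assms by (auto simp: qshift_def)

lemma qshift_neg_power_eq_0:
  assumes "q \<noteq> 0" "n < k"
  shows "qshift (1 / q ^ n) q k = 0"
  using assms by (auto simp: qshift_def intro!: bexI[of _ n])

text \<open>
  Summation by parts: it re-expands a sum in which an operator has sent each basis element \<open>b k\<close>
  to a combination of \<open>b k\<close> and \<open>b (Suc k)\<close>.
\<close>

lemma sum_shifted_basis:
  fixes A B b :: "nat \<Rightarrow> complex"
  shows "(\<Sum>k\<le>N. A k * b k - B k * b (Suc k)) =
    (\<Sum>k\<le>N. (A k - (case k of 0 \<Rightarrow> 0 | Suc j \<Rightarrow> B j)) * b k) - B N * b (Suc N)"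
  by (induction N) (simp_all add: algebra_simps)

section \<open>The three series\<close>

text \<open>
  The summation bound \<open>N\<close> is common to all series considered. A series at \<open>y = q\<^sup>-\<^sup>n\<close> with \<open>n \<le> N\<close>
  is unaffected by it, and all coefficientwise comparisons take place over the same range.
\<close>

locale clausen_params =
  fixes q p x a :: complex and N :: nat
  assumes sqrt_q: "p ^ 2 = q" and q0: "q \<noteq> 0" and a0: "a \<noteq> 0"
    and nz_q: "qshift q q N \<noteq> 0"
    and nz_x2: "qshift (x ^ 2) q N \<noteq> 0"
    and nz_mx: "qshift (- x) q N \<noteq> 0"
    and nz_xp: "qshift (x * p) q N \<noteq> 0"
    and nz_mxp: "qshift (- x * p) q N \<noteq> 0"
begin

definition lin_coeff :: "nat \<Rightarrow> complex" where
  "lin_coeff k = qshift x q k * q ^ k / (qshift q q k * qshift (x ^ 2) q k)"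

definition sq_coeff :: "nat \<Rightarrow> complex" where
  "sq_coeff k = lin_coeff k / (qshift (- x) q k * qshift (x * p) q k * qshift (- x * p) q k)"

definition sym_basis :: "nat \<Rightarrow> complex" where
  "sym_basis k = qshift a q k * qshift (x ^ 2 / a) q k"

definition F :: "complex \<Rightarrow> complex" where
  "F y = (\<Sum>k\<le>N. qshift y q k * lin_coeff k * qshift a q k)"

definition S :: "complex \<Rightarrow> complex" where
  "S y = (\<Sum>k\<le>N. qshift y q k * qshift (x ^ 2 / y) q k * sq_coeff k * sym_basis k)"

text \<open>
  At \<open>k = N\<close> the assumptions allow \<open>1 + x * q ^ k = 0\<close>. The recurrences below use only \<open>T y\<close> and
  \<open>(1 - 1 / y) * T (q * y)\<close> with \<open>qshift y q N = 0\<close>, and then the terms at \<open>k = N\<close> vanish in any case.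
\<close>

definition T :: "complex \<Rightarrow> complex" where
  "T y = (\<Sum>k\<le>N. qshift y q k * qshift (x ^ 2 / y * q) q k * (sq_coeff k / (1 + x * q ^ k))
                  * sym_basis k)"

lemma factors_nonzero:
  assumes "k < N"
  shows "1 - x ^ 2 * q ^ k \<noteq> 0" "1 + x * q ^ k \<noteq> 0"
    "1 - x ^ 2 * q * (q ^ k) ^ 2 \<noteq> 0"
proof -
  have *: "1 - b * q ^ k \<noteq> 0" if "qshift b q N \<noteq> 0" for b
    using qshift_nonzero_mono[OF that, of "Suc k"] assms by (simp add: qshift_Suc)
  show "1 - x ^ 2 * q ^ k \<noteq> 0" "1 + x * q ^ k \<noteq> 0"
    using *[OF nz_x2] *[OF nz_mx] by simp_all
  have "1 - x ^ 2 * q * (q ^ k) ^ 2 = (1 - x * p * q ^ k) * (1 - (- x * p) * q ^ k)"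
    unfolding sqrt_q[symmetric] by (simp add: algebra_simps power2_eq_square)
  then show "1 - x ^ 2 * q * (q ^ k) ^ 2 \<noteq> 0"
    using *[OF nz_xp] *[OF nz_mxp] by simp
qed

lemma lin_coeff_Suc:
  assumes "k < N"
  shows "lin_coeff k * (1 - x * q ^ k) =
    lin_coeff (Suc k) * ((1 - q * q ^ k) * (1 - x ^ 2 * q ^ k)) / q"
proof -
  have "qshift q q (Suc k) \<noteq> 0" "qshift (x ^ 2) q (Suc k) \<noteq> 0"
    using assms qshift_nonzero_mono[OF nz_q] qshift_nonzero_mono[OF nz_x2] by simp_all
  moreover define A B E where "A = 1 - q * q ^ k" and "B = 1 - x ^ 2 * q ^ k" and "E = 1 - x * q ^ k"
  ultimately show ?thesis
    unfolding lin_coeff_def qshift_Suc A_def[symmetric] B_def[symmetric] E_def[symmetric]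
    using q0 by (simp add: field_simps)
qed

lemma sq_coeff_Suc:
  assumes "k < N"
  shows "sq_coeff k * (1 - x * q ^ k) / (1 + x * q ^ k) =
    sq_coeff (Suc k) * ((1 - q * q ^ k) * (1 - x ^ 2 * q ^ k) * (1 - x ^ 2 * q * (q ^ k) ^ 2)) / q"
proof -
  define W where "W k = qshift (- x) q k * qshift (x * p) q k * qshift (- x * p) q k" for k
  have "(1 - x * p * q ^ k) * (1 + x * p * q ^ k) = 1 - x ^ 2 * q * (q ^ k) ^ 2"
    unfolding sqrt_q[symmetric] by (simp add: algebra_simps power2_eq_square)
  then have W: "W (Suc k) = W k * ((1 + x * q ^ k) * (1 - x ^ 2 * q * (q ^ k) ^ 2))"
    by (simp add: W_def qshift_Suc algebra_simps)
  have "W k \<noteq> 0"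
    using assms qshift_nonzero_mono[OF nz_mx] qshift_nonzero_mono[OF nz_xp]
      qshift_nonzero_mono[OF nz_mxp] by (simp add: W_def)
  moreover have "sq_coeff k = lin_coeff k / W k" for k
    by (simp add: sq_coeff_def W_def)
  moreover define P D where "P = 1 + x * q ^ k" and "D = 1 - x ^ 2 * q * (q ^ k) ^ 2"
  moreover have "P \<noteq> 0" "D \<noteq> 0"
    using factors_nonzero[OF assms] by (simp_all add: P_def D_def)
  ultimately have "sq_coeff k * (1 - x * q ^ k) / P = lin_coeff k * (1 - x * q ^ k) / (W k * P)"
    "sq_coeff (Suc k) * D = lin_coeff (Suc k) / (W k * P)"
    using W by simp_all
  note eqs = this
  have "sq_coeff k * (1 - x * q ^ k) / P
      = lin_coeff (Suc k) / (W k * P) * ((1 - q * q ^ k) * (1 - x ^ 2 * q ^ k)) / q"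
    unfolding eqs(1) lin_coeff_Suc[OF assms] by (simp add: mult_ac)
  also have "\<dots> = sq_coeff (Suc k) * ((1 - q * q ^ k) * (1 - x ^ 2 * q ^ k) * D) / q"
    unfolding eqs(2)[symmetric] by (simp only: mult_ac)
  finally show ?thesis by (simp only: P_def D_def)
qed

section \<open>Recurrences\<close>

text \<open>
  The factor \<open>1 - 1 / y\<close> accompanies every passage from \<open>y\<close> to \<open>q * y\<close>. It makes the terms at
  \<open>q * y\<close> multiples of \<open>qshift y q k\<close>, so they vanish at \<open>k = N\<close> as soon as \<open>qshift y q N = 0\<close>; for
  \<open>y = 1\<close> it removes them altogether, and the recurrences then start without a special case.
\<close>

lemma qshift_up:
  assumes "y \<noteq> 0"
  shows "(1 - 1 / y) * qshift (q * y) q k = - (1 / y) * (qshift y q k * (1 - y * q ^ k))"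
proof -
  have "(1 - 1 / y) * qshift (q * y) q k = - (1 / y) * ((1 - y) * qshift (y * q) q k)"
    using assms by (simp add: field_simps)
  then show ?thesis by (simp add: qshift_Suc flip: qshift_Suc_left)
qed

text \<open>
  This is the recurrence that follows from the generating function
  \<open>\<Sum>\<^sub>n (x\<^sup>2;q)\<^sub>n/(q;q)\<^sub>n F(q\<^sup>-\<^sup>n) t\<^sup>n = (a x t;q)\<^sub>\<infinity> (x\<^sup>2 t;q)\<^sub>\<infinity> / ((a t;q)\<^sub>\<infinity> (x t;q)\<^sub>\<infinity>)\<close>.
  Here it is checked on coefficients: the terms multiplied by \<open>a\<close> combine to a single product \<open>u k\<close>,
  and \<open>a (a;q)\<^sub>k = q\<^sup>-\<^sup>k ((a;q)\<^sub>k - (a;q)\<^sub>k\<^sub>+\<^sub>1)\<close> turns multiplication by \<open>a\<close> into an index shift.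
\<close>

lemma F_recurrence:
  assumes y0: "y \<noteq> 0" and yN: "qshift y q N = 0"
  shows "(1 - x ^ 2 / y) * F (y / q) =
    (a + x) * (1 - x / y) * F y - a * x * (1 - 1 / y) * F (q * y)"
proof -
  define u where "u k = qshift y q k * (lin_coeff k * (1 - x * q ^ k))" for k
  have u: "(1 - x / y) * (qshift y q k * lin_coeff k)
      - x * (1 - 1 / y) * (qshift (q * y) q k * lin_coeff k) = u k" for k
  proof -
    have "(1 - x / y) * (qshift y q k * lin_coeff k)
        - x * (1 - 1 / y) * (qshift (q * y) q k * lin_coeff k)
      = ((1 - x / y) * qshift y q k - x * ((1 - 1 / y) * qshift (q * y) q k)) * lin_coeff k"
      by (simp add: algebra_simps)
    also have "\<dots> = u k"
      unfolding qshift_up[OF y0] u_def using y0 by (simp add: field_simps)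
    finally show ?thesis .
  qed
  have step: "u k / q ^ k - (case k of 0 \<Rightarrow> 0 | Suc j \<Rightarrow> u j / q ^ j)
      + x * (1 - x / y) * (qshift y q k * lin_coeff k)
      = (1 - x ^ 2 / y) * (qshift (y / q) q k * lin_coeff k)" if "k \<le> N" for k
  proof (cases k)
    case 0
    then show ?thesis using y0 by (simp add: u_def field_simps power2_eq_square)
  next
    case (Suc j)
    define K Y C where "K = q ^ j" and "Y = qshift y q j" and "C = lin_coeff (Suc j)"
    have "j < N" using that Suc by simp
    have K0: "K \<noteq> 0" using q0 by (simp add: K_def)
    have ly: "qshift (y / q) q (Suc j) = (1 - y / q) * Y"
      using qshift_Suc_left[of "y / q" q j] q0 by (simp add: Y_def)
    \<comment> \<open>The factor \<open>1 - x * K\<close> in \<open>u j\<close> is what allows \<open>lin_coeff j\<close> to be replaced by a multiple of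
      \<open>lin_coeff (Suc j)\<close> even when \<open>x * q ^ j = 1\<close>.\<close>
    have uj: "u j = Y * (C * ((1 - q * K) * (1 - x ^ 2 * K)) / q)"
      unfolding u_def lin_coeff_Suc[OF \<open>j < N\<close>] by (simp add: K_def Y_def C_def)
    have uk: "u (Suc j) = Y * (1 - y * K) * (C * (1 - x * (q * K)))"
      by (simp add: u_def qshift_Suc K_def Y_def C_def)
    have key: "(1 - y * K) * (1 - x * (q * K)) / (q * K)
        - (1 - q * K) * (1 - x ^ 2 * K) / (q * K) + x * (1 - x / y) * (1 - y * K)
      = (1 - x ^ 2 / y) * (1 - y / q)"
      using y0 q0 K0 by (simp add: field_simps power2_eq_square)
    have "u k / q ^ k - (case k of 0 \<Rightarrow> 0 | Suc j \<Rightarrow> u j / q ^ j)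
        + x * (1 - x / y) * (qshift y q k * lin_coeff k)
      = Y * C * ((1 - y * K) * (1 - x * (q * K)) / (q * K)
        - (1 - q * K) * (1 - x ^ 2 * K) / (q * K) + x * (1 - x / y) * (1 - y * K))"
      by (simp add: Suc uj uk qshift_Suc flip: K_def Y_def C_def)
        (simp add: algebra_simps diff_divide_distrib add_divide_distrib)
    also have "\<dots> = (1 - x ^ 2 / y) * (qshift (y / q) q k * lin_coeff k)"
      unfolding key by (simp add: Suc ly flip: C_def)
    finally show ?thesis .
  qed
  have "(1 - x ^ 2 / y) * F (y / q) =
      (\<Sum>k\<le>N. (u k / q ^ k - (case k of 0 \<Rightarrow> 0 | Suc j \<Rightarrow> u j / q ^ j)
        + x * (1 - x / y) * (qshift y q k * lin_coeff k)) * qshift a q k)"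
    unfolding F_def sum_distrib_left using step by (intro sum.cong) (simp_all add: mult.assoc)
  also have "\<dots> = (\<Sum>k\<le>N. (u k / q ^ k - (case k of 0 \<Rightarrow> 0 | Suc j \<Rightarrow> u j / q ^ j)) * qshift a q k)
      + x * (1 - x / y) * F y"
    unfolding F_def sum_distrib_left sum.distrib[symmetric]
    by (intro sum.cong) (simp_all add: algebra_simps)
  also have "(\<Sum>k\<le>N. (u k / q ^ k - (case k of 0 \<Rightarrow> 0 | Suc j \<Rightarrow> u j / q ^ j)) * qshift a q k)
      = (\<Sum>k\<le>N. u k / q ^ k * qshift a q k - u k / q ^ k * qshift a q (Suc k))"
    using sum_shifted_basis[of "\<lambda>k. u k / q ^ k" "qshift a q" "\<lambda>k. u k / q ^ k" N] yN
    by (simp add: u_def)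
  also have "\<dots> = (\<Sum>k\<le>N. a * (u k * qshift a q k))"
    using q0 by (intro sum.cong) (simp_all add: qshift_Suc field_simps)
  also have "\<dots> = a * ((1 - x / y) * F y - x * (1 - 1 / y) * F (q * y))"
    unfolding F_def u[symmetric] sum_distrib_left sum_subtractf[symmetric]
    by (intro sum.cong) (simp_all add: algebra_simps)
  finally have "(1 - x ^ 2 / y) * F (y / q) =
      a * ((1 - x / y) * F y - x * (1 - 1 / y) * F (q * y)) + x * (1 - x / y) * F y" .
  then show ?thesis by (simp only: ring_distribs mult.assoc mult.left_commute[of x a]) simp
qed

text \<open>
  No index shift occurs here: after cancelling common factors, the coefficients agree because
  \<open>1 - x\<^sup>2 K/y = (1 + x K) (1 - x/y) + x/y (1 - y K)\<close> with \<open>K = q\<^sup>k\<close>.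
\<close>

lemma T_recurrence:
  assumes y0: "y \<noteq> 0" and yN: "qshift y q N = 0"
  shows "(1 - x ^ 2 / y) * T y = (1 - x / y) * S y - x * (1 - 1 / y) * T (q * y)"
proof -
  have step: "(1 - x ^ 2 / y) * (qshift y q k * qshift (x ^ 2 / y * q) q k * (sq_coeff k / (1 + x * q ^ k)))
      = (1 - x / y) * (qshift y q k * qshift (x ^ 2 / y) q k * sq_coeff k)
        - x * (1 - 1 / y) * (qshift (q * y) q k * qshift (x ^ 2 / y) q k
            * (sq_coeff k / (1 + x * q ^ k)))" if "k \<le> N" for k
  proof -
    define K Y Z C where "K = q ^ k" and "Y = qshift y q k" and "Z = qshift (x ^ 2 / y) q k"
      and "C = sq_coeff k"
    have up: "(1 - 1 / y) * qshift (q * y) q k = - (1 / y) * (Y * (1 - y * K))"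
      using qshift_up[OF y0] by (simp add: K_def Y_def)
    have left: "(1 - x ^ 2 / y) * qshift (x ^ 2 / y * q) q k = Z * (1 - x ^ 2 / y * K)"
      by (simp only: flip: qshift_Suc_left) (simp add: qshift_Suc Z_def K_def)
    \<comment> \<open>Only at \<open>k = N\<close> may the denominator vanish, and there \<open>Y = 0\<close>.\<close>
    have "Y = 0 \<or> 1 + x * K \<noteq> 0"
      using that yN factors_nonzero(2)[of k] by (cases "k = N") (auto simp: Y_def K_def)
    then have "Y * (Z * (1 - x ^ 2 / y * K)) * (C / (1 + x * K)) =
       (1 - x / y) * (Y * Z * C) - x * (- (1 / y) * (Y * (1 - y * K))) * Z * (C / (1 + x * K))"
    proof
      assume nz: "1 + x * K \<noteq> 0"
      define R where "R = C / (1 + x * K)"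
      have C: "C = R * (1 + x * K)" using nz by (simp add: R_def)
      show ?thesis
        unfolding R_def[symmetric] unfolding C
        using y0 by (simp add: field_simps power2_eq_square)
    qed simp
    then show ?thesis
      unfolding left[symmetric] up[symmetric] by (simp add: Y_def Z_def K_def C_def mult_ac)
  qed
  have z: "x ^ 2 / (q * y) * q = x ^ 2 / y" using q0 by simp
  show ?thesis
    unfolding T_def S_def z sum_distrib_left sum_subtractf[symmetric]
  proof (intro sum.cong refl)
    fix k assume "k \<in> {..N}"
    then show "(1 - x ^ 2 / y) * (qshift y q k * qshift (x ^ 2 / y * q) q k
          * (sq_coeff k / (1 + x * q ^ k)) * sym_basis k)
      = (1 - x / y) * (qshift y q k * qshift (x ^ 2 / y) q k * sq_coeff k * sym_basis k)
        - x * (1 - 1 / y) * (qshift (q * y) q k * qshift (x ^ 2 / y) q k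
            * (sq_coeff k / (1 + x * q ^ k)) * sym_basis k)"
      using arg_cong[OF step[of k], of "\<lambda>t. t * sym_basis k"]
      by (simp only: left_diff_distrib mult.assoc atMost_iff simp_thms)
  qed
qed

text \<open>
  The identity \<open>(1 - a K) (1 - x\<^sup>2 K/a) = (1 + x K)\<^sup>2 - K (a + x)\<^sup>2/a\<close> makes \<open>(a + x)\<^sup>2/a\<close> act
  bidiagonally.
\<close>

lemma sym_basis_mult:
  "(a + x) ^ 2 / a * sym_basis k = ((1 + x * q ^ k) ^ 2 * sym_basis k - sym_basis (Suc k)) / q ^ k"
  using a0 q0 by (simp add: sym_basis_def qshift_Suc field_simps power2_eq_square)

text \<open>
  The relation obtained by squaring the recurrence of \<open>F\<close>, with \<open>F(y)\<^sup>2\<close>, \<open>F(q y)\<^sup>2\<close> and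
  \<open>F(q y) F(y)\<close> replaced by their expansions. Subtracting the mixed term from the square leaves
  coefficients \<open>v k\<close> that are again a single product; this makes the identity for the index shift
  short enough to be verified by expansion.
\<close>

lemma S_recurrence:
  assumes y0: "y \<noteq> 0" and yN: "qshift y q N = 0"
  shows "(1 - x ^ 2 / y) ^ 2 * S (y / q) =
    (a + x) ^ 2 / a * (1 - x / y) * ((1 - x / y) * S y - 2 * x * (1 - 1 / y) * T (q * y))
    + x ^ 2 * (1 - 1 / y) ^ 2 * S (q * y)"
proof -
  define z where "z = x ^ 2 / y"
  define v where "v k = (1 - x ^ 2 / y ^ 2) * (qshift y q k * qshift z q k)
    * (sq_coeff k * (1 - x * q ^ k) / (1 + x * q ^ k))" for k
  have van: "qshift y q k = 0 \<or> 1 + x * q ^ k \<noteq> 0" if "k \<le> N" for k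
    using that yN factors_nonzero(2)[of k] by (cases "k = N") auto
  have v: "(1 - x / y) * ((1 - x / y) * (qshift y q k * qshift z q k * sq_coeff k)
      - 2 * x * (1 - 1 / y) * (qshift (q * y) q k * qshift z q k * (sq_coeff k / (1 + x * q ^ k))))
      = v k" if "k \<le> N" for k
  proof -
    define K Y Z C where "K = q ^ k" and "Y = qshift y q k" and "Z = qshift z q k"
      and "C = sq_coeff k"
    have up: "(1 - 1 / y) * qshift (q * y) q k = - (1 / y) * (Y * (1 - y * K))"
      using qshift_up[OF y0] by (simp add: K_def Y_def)
    have "(1 - x / y) * ((1 - x / y) * (Y * Z * C)
        - 2 * x * (- (1 / y) * (Y * (1 - y * K))) * Z * (C / (1 + x * K)))
      = (1 - x ^ 2 / y ^ 2) * (Y * Z) * (C * (1 - x * K) / (1 + x * K))"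
      using van[OF that, folded Y_def K_def]
    proof
      assume nz: "1 + x * K \<noteq> 0"
      define R where "R = C / (1 + x * K)"
      have C: "C = R * (1 + x * K)" and R': "C * (1 - x * K) / (1 + x * K) = R * (1 - x * K)"
        using nz by (simp_all add: R_def)
      show ?thesis
        unfolding R' R_def[symmetric] unfolding C
        using y0 by (simp add: field_simps power2_eq_square)
    qed simp
    then show ?thesis
      unfolding up[symmetric] by (simp only: v_def Y_def Z_def K_def C_def mult_ac)
  qed
  have step: "v k * (1 + x * q ^ k) ^ 2 / q ^ k - (case k of 0 \<Rightarrow> 0 | Suc j \<Rightarrow> v j / q ^ j)
      + x ^ 2 * (1 - 1 / y) ^ 2 * (qshift (q * y) q k * qshift (z / q) q k * sq_coeff k)
      = (1 - x ^ 2 / y) ^ 2 * (qshift (y / q) q k * qshift (z * q) q k * sq_coeff k)"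
    if "k \<le> N" for k
  proof (cases k)
    case 0
    have "1 + x \<noteq> 0" using van[of 0] by simp
    then have "v 0 * (1 + x) ^ 2 = (1 - x ^ 2 / y ^ 2) * (1 - x) * (1 + x) * sq_coeff 0"
      by (simp add: v_def power2_eq_square)
    then show ?thesis
      unfolding 0 using y0 by (simp add: field_simps power2_eq_square)
  next
    case (Suc j)
    define K Y Z C where "K = q ^ j" and "Y = qshift y q j" and "Z = qshift z q j"
      and "C = sq_coeff (Suc j)"
    have "j < N" using that Suc by simp
    have K0: "K \<noteq> 0" using q0 by (simp add: K_def)
    have key: "(1 - x ^ 2 / y ^ 2) * ((1 - y * K) * (1 - z * K) * (1 - x ^ 2 * (q * K) ^ 2) / (q * K)
        - (1 - q * K) * (1 - x ^ 2 * K) * (1 - x ^ 2 * q * K ^ 2) / (q * K))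
        - x ^ 2 * (1 - 1 / y) * (1 / y) * (1 - y * K) * (1 - y * (q * K)) * (1 - z / q)
      = (1 - x ^ 2 / y) * (1 - y / q) * (1 - z * K) * (1 - z * (q * K))"
      using y0 q0 K0 by (simp add: z_def field_simps power2_eq_square)
    have vj: "v j = (1 - x ^ 2 / y ^ 2) * (Y * Z)
        * (C * ((1 - q * K) * (1 - x ^ 2 * K) * (1 - x ^ 2 * q * K ^ 2)) / q)"
      unfolding v_def sq_coeff_Suc[OF \<open>j < N\<close>] by (simp add: K_def Y_def Z_def C_def)
    have vk: "v k * (1 + x * q ^ k) ^ 2 = (1 - x ^ 2 / y ^ 2)
        * (Y * (1 - y * K) * (Z * (1 - z * K))) * (C * (1 - x ^ 2 * (q * K) ^ 2))"
    proof -
      have "v k * (1 + x * q ^ k) ^ 2 = (1 - x ^ 2 / y ^ 2) * (qshift y q k * qshift z q k)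
          * (sq_coeff k * (1 - x ^ 2 * (q ^ k) ^ 2))"
        using van[OF that]
      proof
        assume nz: "1 + x * q ^ k \<noteq> 0"
        have sq: "1 - x ^ 2 * (q ^ k) ^ 2 = (1 - x * q ^ k) * (1 + x * q ^ k)"
          by (simp add: algebra_simps power2_eq_square)
        have "e * (c * m / P) * P ^ 2 = e * (c * (m * P))" if "P \<noteq> 0" for e c m P :: complex
          using that by (simp add: power2_eq_square)
        then show ?thesis unfolding v_def sq using nz by blast
      qed (simp add: v_def)
      then show ?thesis by (simp add: Suc qshift_Suc K_def Y_def Z_def C_def)
    qed
    have ly: "qshift (y / q) q k = (1 - y / q) * Y"
      using qshift_Suc_left[of "y / q" q j] q0 by (simp add: Y_def Suc)
    have lz: "qshift (z / q) q k = (1 - z / q) * Z"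
      using qshift_Suc_left[of "z / q" q j] q0 by (simp add: Z_def Suc)
    have uz: "(1 - z) * qshift (z * q) q k = Z * (1 - z * K) * (1 - z * (q * K))"
      unfolding Suc qshift_Suc_left[symmetric] by (simp add: qshift_Suc Z_def K_def)
    have uy: "(1 - 1 / y) * qshift (q * y) q k = - (1 / y) * (Y * (1 - y * K) * (1 - y * (q * K)))"
      unfolding qshift_up[OF y0] by (simp add: Suc qshift_Suc Y_def K_def)
    have "v k * (1 + x * q ^ k) ^ 2 / q ^ k - (case k of 0 \<Rightarrow> 0 | Suc j \<Rightarrow> v j / q ^ j)
        + x ^ 2 * (1 - 1 / y) ^ 2 * (qshift (q * y) q k * qshift (z / q) q k * sq_coeff k)
      = v k * (1 + x * q ^ k) ^ 2 / (q * K) - v j / K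
        + x ^ 2 * (1 - 1 / y) * ((1 - 1 / y) * qshift (q * y) q k) * ((1 - z / q) * Z) * C"
      by (simp add: Suc K_def C_def lz[unfolded Suc] power2_eq_square mult_ac)
    also have "\<dots> = Y * Z * C * ((1 - x ^ 2 / y ^ 2)
          * ((1 - y * K) * (1 - z * K) * (1 - x ^ 2 * (q * K) ^ 2) / (q * K)
            - (1 - q * K) * (1 - x ^ 2 * K) * (1 - x ^ 2 * q * K ^ 2) / (q * K))
        - x ^ 2 * (1 - 1 / y) * (1 / y) * (1 - y * K) * (1 - y * (q * K)) * (1 - z / q))"
      unfolding vk vj uy
      by (simp only: ring_distribs diff_divide_distrib divide_divide_eq_left) (simp add: mult_ac)
    also have "\<dots> = (1 - x ^ 2 / y) * ((1 - y / q) * Y) * ((1 - z) * qshift (z * q) q k) * C"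
      unfolding key uz by (simp add: mult_ac)
    also have "\<dots> = (1 - x ^ 2 / y) ^ 2 * (qshift (y / q) q k * qshift (z * q) q k * sq_coeff k)"
      unfolding Suc ly[unfolded Suc] C_def by (simp add: z_def power2_eq_square mult_ac)
    finally show ?thesis .
  qed
  have args: "x ^ 2 / (y / q) = z * q" "x ^ 2 / (q * y) = z / q" "z / q * q = z" "x ^ 2 / y = z"
    using q0 by (simp_all add: z_def)
  have "(1 - x ^ 2 / y) ^ 2 * S (y / q) =
      (\<Sum>k\<le>N. (v k * (1 + x * q ^ k) ^ 2 / q ^ k - (case k of 0 \<Rightarrow> 0 | Suc j \<Rightarrow> v j / q ^ j)
        + x ^ 2 * (1 - 1 / y) ^ 2 * (qshift (q * y) q k * qshift (z / q) q k * sq_coeff k))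
        * sym_basis k)"
    unfolding S_def args(1) sum_distrib_left using step by (intro sum.cong) (simp_all add: mult.assoc)
  also have "\<dots> = (\<Sum>k\<le>N. (v k * (1 + x * q ^ k) ^ 2 / q ^ k
        - (case k of 0 \<Rightarrow> 0 | Suc j \<Rightarrow> v j / q ^ j)) * sym_basis k)
      + x ^ 2 * (1 - 1 / y) ^ 2 * S (q * y)"
    unfolding S_def args(2) sum_distrib_left sum.distrib[symmetric]
    by (intro sum.cong) (simp_all add: ring_distribs mult.assoc)
  also have "(\<Sum>k\<le>N. (v k * (1 + x * q ^ k) ^ 2 / q ^ k
        - (case k of 0 \<Rightarrow> 0 | Suc j \<Rightarrow> v j / q ^ j)) * sym_basis k)
      = (\<Sum>k\<le>N. v k * (1 + x * q ^ k) ^ 2 / q ^ k * sym_basis k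
          - v k / q ^ k * sym_basis (Suc k))"
    using sum_shifted_basis[of "\<lambda>k. v k * (1 + x * q ^ k) ^ 2 / q ^ k" sym_basis "\<lambda>k. v k / q ^ k" N] yN
    by (simp add: v_def)
  also have "\<dots> = (\<Sum>k\<le>N. (a + x) ^ 2 / a * (v k * sym_basis k))"
  proof (intro sum.cong refl)
    fix k
    have "(a + x) ^ 2 / a * (v k * sym_basis k) = v k * ((a + x) ^ 2 / a * sym_basis k)"
      by (simp only: mult_ac)
    then show "v k * (1 + x * q ^ k) ^ 2 / q ^ k * sym_basis k - v k / q ^ k * sym_basis (Suc k)
        = (a + x) ^ 2 / a * (v k * sym_basis k)"
      unfolding sym_basis_mult by (simp add: diff_divide_distrib right_diff_distrib)
  qed
  also have "\<dots> = (a + x) ^ 2 / a * ((1 - x / y) * ((1 - x / y) * S y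
      - 2 * x * (1 - 1 / y) * T (q * y)))"
    unfolding S_def T_def args sum_distrib_left sum_subtractf[symmetric]
  proof (intro sum.cong refl)
    fix k assume "k \<in> {..N}"
    then have "v k = (1 - x / y) * ((1 - x / y) * (qshift y q k * qshift z q k * sq_coeff k)
        - 2 * x * (1 - 1 / y) * (qshift (q * y) q k * qshift z q k * (sq_coeff k / (1 + x * q ^ k))))"
      using v[of k] by simp
    then show "(a + x) ^ 2 / a * (v k * sym_basis k) = (a + x) ^ 2 / a * ((1 - x / y)
        * ((1 - x / y) * (qshift y q k * qshift z q k * sq_coeff k * sym_basis k)
          - 2 * x * (1 - 1 / y) * (qshift (q * y) q k * qshift z q k
              * (sq_coeff k / (1 + x * q ^ k)) * sym_basis k)))"
      by (simp only: right_diff_distrib left_diff_distrib mult.assoc)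
  qed
  finally show ?thesis by (simp add: mult.assoc)
qed

section \<open>The product formulas\<close>

lemma F_S_at_1: "F 1 = 1" "S 1 = 1"
proof -
  have one: "qshift 1 q k = (if k = 0 then 1 else 0)" for k
    by (cases k) (simp_all add: qshift_Suc_left)
  have "F 1 = (\<Sum>k\<in>{0}. qshift 1 q k * lin_coeff k * qshift a q k)"
    unfolding F_def by (rule sum.mono_neutral_right) (auto simp: one)
  then show "F 1 = 1" by (simp add: lin_coeff_def)
  have "S 1 = (\<Sum>k\<in>{0}. qshift 1 q k * qshift (x ^ 2 / 1) q k * sq_coeff k * sym_basis k)"
    unfolding S_def by (rule sum.mono_neutral_right) (auto simp: one)
  then show "S 1 = 1" by (simp add: lin_coeff_def sq_coeff_def sym_basis_def)
qed

text \<open>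
  The formula for the square is carried along with those for the mixed product and the square at the
  preceding index. The factor \<open>1 - 1 / y\<close>, with which the recurrences use the last two, makes them
  void at \<open>n = 0\<close>, and multiplying by \<open>a\<close> avoids the exponent \<open>n - 1\<close>.
\<close>

lemma product_formulas:
  assumes "n \<le> N"
  defines "y \<equiv> 1 / q ^ n"
  shows "F y ^ 2 = a ^ n * S y
    \<and> (1 - 1 / y) * (a * (F (q * y) * F y)) = (1 - 1 / y) * ((a + x) * a ^ n * T (q * y))
    \<and> (1 - 1 / y) * (a * F (q * y) ^ 2) = (1 - 1 / y) * (a ^ n * S (q * y))"
  using assms(1) unfolding y_def
proof (induction n)
  case 0
  then show ?case by (simp add: F_S_at_1)
next
  case (Suc n)
  define y where "y = 1 / q ^ n"
  define \<alpha> \<beta> \<gamma> where "\<alpha> = 1 - x ^ 2 / y" and "\<beta> = 1 - x / y" and "\<gamma> = 1 - 1 / y"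
  define f f' f'' where "f = F y" and "f' = F (q * y)" and "f'' = F (y / q)"
  have y0: "y \<noteq> 0" using q0 by (simp add: y_def)
  have yN: "qshift y q N = 0"
    using qshift_neg_power_eq_0[OF q0] Suc.prems by (simp add: y_def)
  have \<alpha>: "\<alpha> \<noteq> 0"
    using factors_nonzero(1)[of n] Suc.prems by (simp add: \<alpha>_def y_def)
  have IH: "f ^ 2 = a ^ n * S y" "\<gamma> * (a * (f' * f)) = \<gamma> * ((a + x) * a ^ n * T (q * y))"
     "\<gamma> * (a * f' ^ 2) = \<gamma> * (a ^ n * S (q * y))"
    using Suc by (simp_all add: y_def \<gamma>_def f_def f'_def)
  have F: "\<alpha> * f'' = (a + x) * \<beta> * f - a * x * \<gamma> * f'"
    using F_recurrence[OF y0 yN] by (simp only: \<alpha>_def \<beta>_def \<gamma>_def f_def f'_def f''_def)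
  have T: "\<alpha> * T y = \<beta> * S y - x * \<gamma> * T (q * y)"
    using T_recurrence[OF y0 yN] by (simp only: \<alpha>_def \<beta>_def \<gamma>_def)
  have S: "\<alpha> ^ 2 * S (y / q) = (a + x) ^ 2 / a * \<beta> * (\<beta> * S y - 2 * x * \<gamma> * T (q * y))
      + x ^ 2 * \<gamma> ^ 2 * S (q * y)"
    using S_recurrence[OF y0 yN] by (simp only: \<alpha>_def \<beta>_def \<gamma>_def)
  have "\<alpha> * (f * f'') = f * ((a + x) * \<beta> * f - a * x * \<gamma> * f')"
    unfolding F[symmetric] by simp
  also have "\<dots> = (a + x) * \<beta> * f ^ 2 - x * (\<gamma> * (a * (f' * f)))"
    by (simp add: algebra_simps power2_eq_square)
  also have "\<dots> = \<alpha> * ((a + x) * a ^ n * T y)"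
    unfolding IH mult.left_commute[of \<alpha>] T by (simp add: algebra_simps)
  finally have A: "f * f'' = (a + x) * a ^ n * T y" using \<alpha> by simp
  have "\<alpha> ^ 2 * f'' ^ 2 = (\<alpha> * f'') ^ 2" by (simp add: power_mult_distrib)
  also have "\<dots> = (a + x) ^ 2 * \<beta> ^ 2 * f ^ 2 - 2 * (a + x) * x * \<beta> * \<gamma> * (a * (f' * f))
      + a * x ^ 2 * \<gamma> * (\<gamma> * (a * f' ^ 2))"
    unfolding F by (simp add: algebra_simps power2_eq_square)
  also have "\<dots> = (a + x) ^ 2 * \<beta> ^ 2 * (a ^ n * S y) - 2 * (a + x) * x * \<beta>
      * (\<gamma> * ((a + x) * a ^ n * T (q * y))) + a * x ^ 2 * \<gamma> * (\<gamma> * (a ^ n * S (q * y)))"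
    unfolding IH(1) IH(2,3)[symmetric] by (simp add: mult.assoc)
  also have "\<dots> = a ^ Suc n * (\<alpha> ^ 2 * S (y / q))"
    unfolding S using a0 by (simp add: field_simps power2_eq_square)
  finally have "f'' ^ 2 = a ^ Suc n * S (y / q)" using \<alpha> by simp
  moreover have "1 / q ^ Suc n = y / q" "q * (y / q) = y"
    using q0 by (simp_all add: y_def)
  ultimately show ?case
    using A IH(1) by (simp add: f_def f''_def)
qed

end

theorem corollary1p2:
  fixes n :: nat and q p a x :: complex
  assumes sqrt_q: "p ^ 2 = q"
    and "q \<noteq> 0" and "a \<noteq> 0"
    and "\<forall>k\<le>n. qshift q q k \<noteq> 0"
    and "\<forall>k\<le>n. qshift (x ^ 2) q k \<noteq> 0"
    and "\<forall>k\<le>n. qshift (- x) q k \<noteq> 0"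
    and "\<forall>k\<le>n. qshift (x * p) q k \<noteq> 0"
    and "\<forall>k\<le>n. qshift (- x * p) q k \<noteq> 0"
  shows "(basic_hypergeometric [q powi (- int n), a, x] [x ^ 2, 0] q q) ^ 2 =
    a ^ n * basic_hypergeometric
      [q powi (- int n), x ^ 2 * q ^ n, a, x ^ 2 / a, x]
      [x ^ 2, - x, x * p, - x * p] q q"
proof -
  interpret clausen_params q p x a n
    using assms by unfold_locales auto
  define y where "y = 1 / q ^ n"
  have y: "q powi (- int n) = y" "x ^ 2 * q ^ n = x ^ 2 / y"
    by (simp_all add: y_def power_int_minus divide_inverse)
  have zero: "qshift y q k = 0" if "k \<notin> {..n}" for k
    using qshift_neg_power_eq_0[OF assms(2)] that by (simp add: y_def)
  have "qshift 0 q k = 1" for k by (simp add: qshift_def)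
  then have "basic_hypergeometric [y, a, x] [x ^ 2, 0] q q = F y"
    unfolding basic_hypergeometric_def F_def
    by (subst suminf_finite[of "{..n}"]) (auto simp: zero lin_coeff_def mult_ac)
  moreover have "basic_hypergeometric [y, x ^ 2 / y, a, x ^ 2 / a, x]
      [x ^ 2, - x, x * p, - x * p] q q = S y"
    unfolding basic_hypergeometric_def S_def
    by (subst suminf_finite[of "{..n}"])
      (auto simp: zero sq_coeff_def lin_coeff_def sym_basis_def mult_ac)
  ultimately show ?thesis
    using product_formulas[of n] unfolding y by (simp add: y_def)
qed

end
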